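(* Let $\mathbb{F}$ be $\mathbb{R}$ or $\mathbb{C}$, let $k\ge 2$, $t\ge 1$, and let $U=(u_{is})$, $V=(v_{js})$, $W=(w_{rs})$ be $k^2\times t$ matrices over $\mathbb{F}$ that determine a bilinear non-commutative algorithm for multiplying $k\times k$ matrices. Let $n$ be a power of $k$, and consider the recursive (stationary partition) algorithm for multiplying $n\times n$ matrices obtained from $U,V,W$, executed in rounded arithmetic with machine precision $\varepsilon$. This algorithm is stable: for all $n\times n$ matrices $A,B$ over $\mathbb{F}$, with exact product $C=AB$ and computed output $C_{comp}$, $$\|C_{comp}-C\|\le \mu(n)\,\varepsilon\,\|A\|\,\|B\|+O(\varepsilon^2),$$ where $\|M\|=\max_{i,j}|m_{ij}|$ is the maximum-entry norm and $$\mu(n)=\Bigl(1+\max_{r,s}(\alpha_s+\beta_s+\gamma_r+3)\,\log_k n\Bigr)\cdot\bigl(\mathrm{emax}\cdot\|U\|\,\|V\|\,\|W\|\bigr)^{\log_k n}.$$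
   Context: Rounded arithmetic: every execution of an operation $op\in\{+,-,\cdot\}$ (including multiplication by an entry of $U$, $V$ or $W$) on operands $a,b\in\mathbb{F}$ returns $op(a,b)(1+\theta)$ with $|\theta|\le\varepsilon$, $\theta$ otherwise arbitrary and possibly different at each execution. The term $O(\varepsilon^2)$ refers to $\varepsilon\to0$ with $n$, $A$, $B$ and the algorithm fixed, uniformly over all choices of the errors $\theta$. Bilinear non-commutative algorithm: $k^2\times t$ matrices $U,V,W$ such that, for non-commuting entries (so that entries may be replaced by square matrix blocks), the product $C=AB$ of $k\times k$ matrices is given by $$c_{hl}=\sum_{s=1}^t w_{rs}P_s,\qquad P_s=\Bigl(\sum_{i=1}^{k^2}u_{is}x_i\Bigr)\Bigl(\sum_{j=1}^{k^2}v_{js}y_j\Bigr),\qquad r=k(h-1)+l,\quad h,l=1,\dots,k,$$ where $x_i$ (resp. $y_j$) are the entries of $A$ (resp. $B$) ordered column-wise. Recursive algorithm for $n=k^p$: partition $A$ and $B$ into $k^2$ square blocks of size $(n/k)\times(n/k)$; denoting by $X_i$ (resp. $Y_j$) the blocks of $A$ (resp. $B$) ordered column-wise, compute the blocks $C_{hl}$ of $C$ by $$C_{hl}=\sum_{s=1}^t w_{rs}P_s,\qquad P_s=\Bigl(\sum_{i=1}^{k^2}u_{is}X_i\Bigr)\Bigl(\sum_{j=1}^{k^2}v_{js}Y_j\Bigr),\qquad r=k(h-1)+l,\quad h,l=1,\dots,k,$$ where the $t$ products $P_s$ of $(n/k)\times(n/k)$ matrices are computed recursively by the same procedure, and $1\times1$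 products are scalar multiplications. In each linear combination only the terms with nonzero coefficients are used; each such term is multiplied by its coefficient, and the resulting $m$ terms are added by balanced pairwise summation (recursively adding the sum of the first $\lceil m/2\rceil$ terms and the sum of the remaining terms), so each term passes through at most $\lceil\log_2 m\rceil$ additions. Quantities: $a_s=\#\{i:u_{is}\ne0\}$, $b_s=\#\{j:v_{js}\neq0\}$ for $s=1,\dots,t$; $c_r=\#\{s:w_{rs}\neq0\}$ for $r=1,\dots,k^2$; $\alpha_s=\lceil\log_2a_s\rceil$, $\beta_s=\lceil\log_2b_s\rceil$, $\gamma_r=\lceil\log_2c_r\rceil$ (with $\lceil\log_2 0\rceil$ read as $0$). Let $\xi_{rs}=1$ if $w_{rs}\ne0$ and $\xi_{rs}=0$ otherwise, $\mathrm{e}_r=\sum_{s=1}^t a_sb_s\xi_{rs}$, and $\mathrm{emax}=\max_r \mathrm{e}_r$. *)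

theory Defs
  imports
    "HOL-Library.Landau_Symbols"
    "HOL-Library.Log_Nat"
    "Jordan_Normal_Form.Matrix"
begin

text \<open>
  The field is an arbitrary type of class \<open>real_normed_field\<close>; by the theorem of Gelfand and Mazur
  the instances are, up to isometric isomorphism, exactly the real and the complex numbers.
  All indices start at 0: the 1-based index \<open>r = k (h - 1) + l\<close> of an entry of the product
  becomes \<open>k * h + l\<close>.
\<close>

definition max_norm :: "'a::real_normed_field mat \<Rightarrow> real" where
  "max_norm M = Max (norm ` elements_mat M)"


subsection \<open>Bilinear non-commutative algorithms\<close>

definition mat_sum :: "nat \<Rightarrow> nat \<Rightarrow> (nat \<Rightarrow> 'a::real_normed_field mat) \<Rightarrow> 'a mat" where
  "mat_sum d N F = mat d d (\<lambda>(i, j). \<Sum>q<N. F q $$ (i, j))"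

definition colwise :: "nat \<Rightarrow> (nat \<Rightarrow> nat \<Rightarrow> 'b) \<Rightarrow> nat \<Rightarrow> 'b" where
  "colwise k A i = A (i mod k) (i div k)"

text \<open>
  The non-commuting entries range over the square matrices of every size \<open>d\<close>. Matrices of all
  sizes satisfy no common polynomial identity, so this is the identity in non-commuting variables.
\<close>

definition bilinear_algorithm ::
  "nat \<Rightarrow> nat \<Rightarrow> 'a::real_normed_field mat \<Rightarrow> 'a mat \<Rightarrow> 'a mat \<Rightarrow> bool" where
  "bilinear_algorithm k t U V W \<longleftrightarrow>
     U \<in> carrier_mat (k\<^sup>2) t \<and> V \<in> carrier_mat (k\<^sup>2) t \<and> W \<in> carrier_mat (k\<^sup>2) t \<and>
     (\<forall>d A B.
        (\<forall>h<k. \<forall>l<k. A h l \<in> carrier_mat d d \<and> B h l \<in> carrier_mat d d) \<longrightarrow>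
        (\<forall>h<k. \<forall>l<k.
           mat_sum d k (\<lambda>q. A h q * B q l) =
           mat_sum d t (\<lambda>s. W $$ (k * h + l, s) \<cdot>\<^sub>m
             (mat_sum d (k\<^sup>2) (\<lambda>i. U $$ (i, s) \<cdot>\<^sub>m colwise k A i) *
              mat_sum d (k\<^sup>2) (\<lambda>j. V $$ (j, s) \<cdot>\<^sub>m colwise k B j)))))"


subsection \<open>Rounded arithmetic\<close>

text \<open>
  Rounded operations are relations between the operands and every result that some choice of the
  errors can produce; each execution chooses its own error.
\<close>

definition rounded :: "real \<Rightarrow> 'a::real_normed_field \<Rightarrow> 'a \<Rightarrow> bool" where
  "rounded \<epsilon> x y \<longleftrightarrow> (\<exists>\<theta>. norm \<theta> \<le> \<epsilon> \<and> y = x * (1 + \<theta>))"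

definition fl_add_mat ::
  "real \<Rightarrow> nat \<Rightarrow> 'a::real_normed_field mat \<Rightarrow> 'a mat \<Rightarrow> 'a mat \<Rightarrow> bool" where
  "fl_add_mat \<epsilon> d X Y Z \<longleftrightarrow> Z \<in> carrier_mat d d \<and>
     (\<forall>i<d. \<forall>j<d. rounded \<epsilon> (X $$ (i, j) + Y $$ (i, j)) (Z $$ (i, j)))"

definition fl_smult_mat ::
  "real \<Rightarrow> nat \<Rightarrow> 'a::real_normed_field \<Rightarrow> 'a mat \<Rightarrow> 'a mat \<Rightarrow> bool" where
  "fl_smult_mat \<epsilon> d c X Z \<longleftrightarrow> Z \<in> carrier_mat d d \<and>
     (\<forall>i<d. \<forall>j<d. rounded \<epsilon> (c * X $$ (i, j)) (Z $$ (i, j)))"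

text \<open>
  Balanced pairwise summation; \<open>(m + 1) div 2\<close> is the ceiling of \<open>m / 2\<close>. The empty sum, which
  arises when all coefficients of a linear combination vanish, is the exact zero matrix.
\<close>

inductive fl_pairwise_sum ::
  "real \<Rightarrow> nat \<Rightarrow> 'a::real_normed_field mat list \<Rightarrow> 'a mat \<Rightarrow> bool"
  for \<epsilon> :: real and d :: nat where
  empty: "fl_pairwise_sum \<epsilon> d [] (0\<^sub>m d d)"
| single: "fl_pairwise_sum \<epsilon> d [X] X"
| split: "length Xs \<ge> 2 \<Longrightarrow>
    fl_pairwise_sum \<epsilon> d (take ((length Xs + 1) div 2) Xs) S \<Longrightarrow>
    fl_pairwise_sum \<epsilon> d (drop ((length Xs + 1) div 2) Xs) T \<Longrightarrow>
    fl_add_mat \<epsilon> d S T Z \<Longrightarrow>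
    fl_pairwise_sum \<epsilon> d Xs Z"

definition fl_lincomb ::
  "real \<Rightarrow> nat \<Rightarrow> nat \<Rightarrow> (nat \<Rightarrow> 'a::real_normed_field) \<Rightarrow> (nat \<Rightarrow> 'a mat) \<Rightarrow> 'a mat \<Rightarrow> bool" where
  "fl_lincomb \<epsilon> d N c X Z \<longleftrightarrow>
     (\<exists>T. list_all2 (\<lambda>i. fl_smult_mat \<epsilon> d (c i) (X i)) (filter (\<lambda>i. c i \<noteq> 0) [0..<N]) T \<and>
          fl_pairwise_sum \<epsilon> d T Z)"


subsection \<open>The recursive algorithm\<close>

definition block :: "nat \<Rightarrow> 'a mat \<Rightarrow> nat \<Rightarrow> nat \<Rightarrow> 'a mat" where
  "block d M h l = mat d d (\<lambda>(i, j). M $$ (h * d + i, l * d + j))"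

text \<open>
  \<open>fl_rec_mult \<epsilon> k t U V W p A B C\<close>: the algorithm run on the \<open>k ^ p \<times> k ^ p\<close> matrices \<open>A\<close>, \<open>B\<close>
  can return \<open>C\<close>. The computed factors \<open>L s\<close>, \<open>R s\<close> and products \<open>P s\<close> are shared by all blocks
  of \<open>C\<close>.
\<close>

primrec fl_rec_mult ::
  "real \<Rightarrow> nat \<Rightarrow> nat \<Rightarrow> 'a::real_normed_field mat \<Rightarrow> 'a mat \<Rightarrow> 'a mat \<Rightarrow> nat \<Rightarrow>
   'a mat \<Rightarrow> 'a mat \<Rightarrow> 'a mat \<Rightarrow> bool" where
  "fl_rec_mult \<epsilon> k t U V W 0 A B C \<longleftrightarrow>
     C \<in> carrier_mat 1 1 \<and> rounded \<epsilon> (A $$ (0, 0) * B $$ (0, 0)) (C $$ (0, 0))"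
| "fl_rec_mult \<epsilon> k t U V W (Suc p) A B C \<longleftrightarrow>
     C \<in> carrier_mat (k ^ Suc p) (k ^ Suc p) \<and>
     (\<exists>L R P.
        (\<forall>s<t.
           fl_lincomb \<epsilon> (k ^ p) (k\<^sup>2) (\<lambda>i. U $$ (i, s)) (colwise k (block (k ^ p) A)) (L s) \<and>
           fl_lincomb \<epsilon> (k ^ p) (k\<^sup>2) (\<lambda>j. V $$ (j, s)) (colwise k (block (k ^ p) B)) (R s) \<and>
           fl_rec_mult \<epsilon> k t U V W p (L s) (R s) (P s)) \<and>
        (\<forall>h<k. \<forall>l<k.
           fl_lincomb \<epsilon> (k ^ p) t (\<lambda>s. W $$ (k * h + l, s)) P (block (k ^ p) C h l)))"


subsection \<open>The error bound\<close>

definition nnz_col :: "'a::zero mat \<Rightarrow> nat \<Rightarrow> nat" where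
  "nnz_col M s = card {i. i < dim_row M \<and> M $$ (i, s) \<noteq> 0}"

definition nnz_row :: "'a::zero mat \<Rightarrow> nat \<Rightarrow> nat" where
  "nnz_row M r = card {s. s < dim_col M \<and> M $$ (r, s) \<noteq> 0}"

definition emax :: "nat \<Rightarrow> nat \<Rightarrow> 'a::zero mat \<Rightarrow> 'a mat \<Rightarrow> 'a mat \<Rightarrow> nat" where
  "emax k t U V W =
     (MAX r\<in>{..<k\<^sup>2}. \<Sum>s<t. nnz_col U s * nnz_col V s * of_bool (W $$ (r, s) \<noteq> 0))"

definition \<mu> ::
  "nat \<Rightarrow> nat \<Rightarrow> 'a::real_normed_field mat \<Rightarrow> 'a mat \<Rightarrow> 'a mat \<Rightarrow> nat \<Rightarrow> real" where
  "\<mu> k t U V W n =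
     (1 + real (MAX (r, s)\<in>{..<k\<^sup>2} \<times> {..<t}.
            ceillog2 (nnz_col U s) + ceillog2 (nnz_col V s) + ceillog2 (nnz_row W r) + 3)
          * log (real k) (real n)) *
     (real (emax k t U V W) * max_norm U * max_norm V * max_norm W) powr log (real k) (real n)"

end

theory Submission
  imports Defs
begin

text \<open>
  Call \<open>y\<close> an approximation of \<open>x\<close> of order \<open>m\<close> and size \<open>b\<close> if \<open>|x| \<le> b\<close> and
  \<open>|y - x| \<le> ((1 + \<epsilon>)\<^sup>m - 1) b\<close>. Rounding raises the order by one, addition adds the sizes, and
  multiplication adds the orders and multiplies the sizes. By induction on \<open>p\<close>, the recursive
  algorithm applied to approximations of \<open>A\<close> and \<open>B\<close> of orders \<open>m\<^sub>1\<close>, \<open>m\<^sub>2\<close> and sizes \<open>a\<close>, \<open>b\<close>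
  returns an approximation of \<open>AB\<close> of order \<open>m\<^sub>1 + m\<^sub>2 + 1 + M p\<close> and size \<open>K\<^sup>p a b\<close>, where
  \<open>M = max (\<alpha>\<^sub>s + \<beta>\<^sub>s + \<gamma>\<^sub>r + 3)\<close> and \<open>K = emax \<parallel>U\<parallel> \<parallel>V\<parallel> \<parallel>W\<parallel>\<close>. Allowing inexact inputs is what
  makes the induction go through, because the factors passed to the recursive calls are already
  rounded.
\<close>

section \<open>Arithmetic of approximations under rounding\<close>

definition approximates :: "real \<Rightarrow> nat \<Rightarrow> real \<Rightarrow> 'a::real_normed_field \<Rightarrow> 'a \<Rightarrow> bool" where
  "approximates \<epsilon> m b x y \<longleftrightarrow> norm x \<le> b \<and> norm (y - x) \<le> ((1 + \<epsilon>) ^ m - 1) * b"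

lemma approximates_refl: "approximates \<epsilon> 0 (norm x) x x"
  by (simp add: approximates_def)

lemma approximates_mono:
  assumes "approximates \<epsilon> m b x y" "\<epsilon> \<ge> 0" "m \<le> m'" "b \<le> b'"
  shows "approximates \<epsilon> m' b' x y"
proof -
  have b: "0 \<le> b" "0 \<le> b'"
    using assms(1,4) norm_ge_zero[of x] unfolding approximates_def by linarith+
  have "1 \<le> (1 + \<epsilon>) ^ m'" using assms(2) by simp
  moreover have "(1 + \<epsilon>) ^ m \<le> (1 + \<epsilon>) ^ m'"
    using assms by (intro power_increasing) auto
  ultimately have "((1 + \<epsilon>) ^ m - 1) * b \<le> ((1 + \<epsilon>) ^ m' - 1) * b'"
    using b assms by (intro mult_mono) auto
  then show ?thesis
    using assms by (auto simp: approximates_def)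
qed

text \<open>The error splits as \<open>(y - x) * (1 + \<theta>) + x * \<theta>\<close>, and
  \<open>((1 + \<epsilon>) ^ m - 1) * (1 + \<epsilon>) + \<epsilon> = (1 + \<epsilon>) ^ Suc m -
  1\<close>.\<close>

lemma approximates_rounded:
  assumes "approximates \<epsilon> m b x y" "rounded \<epsilon> y z" "\<epsilon> \<ge> 0"
  shows "approximates \<epsilon> (Suc m) b x z"
proof -
  obtain \<theta> where \<theta>: "norm \<theta> \<le> \<epsilon>" "z = y * (1 + \<theta>)"
    using assms(2) unfolding rounded_def by blast
  have "norm (1 + \<theta>) \<le> 1 + \<epsilon>"
    using norm_triangle_ineq[of 1 \<theta>] \<theta>(1) by simp
  have "z - x = (y - x) * (1 + \<theta>) + x * \<theta>"
    unfolding \<theta>(2) by (simp add: algebra_simps)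
  then have "norm (z - x) \<le> norm (y - x) * norm (1 + \<theta>) + norm x * norm \<theta>"
    by (metis norm_mult norm_triangle_ineq)
  also have "\<dots> \<le> ((1 + \<epsilon>) ^ m - 1) * b * (1 + \<epsilon>) + b * \<epsilon>"
    using assms(1) \<theta>(1) \<open>norm (1 + \<theta>) \<le> 1 + \<epsilon>\<close> unfolding approximates_def
    by (intro add_mono mult_mono) (auto intro: order_trans[OF norm_ge_zero])
  also have "\<dots> = ((1 + \<epsilon>) ^ Suc m - 1) * b"
    by (simp add: algebra_simps)
  finally show ?thesis
    using assms(1) by (simp add: approximates_def)
qed

lemma approximates_add:
  assumes "approximates \<epsilon> m b x y" "approximates \<epsilon> m b' x' y'"
  shows "approximates \<epsilon> m (b + b') (x + x') (y + y')"
  using assms norm_triangle_ineq[of x x'] norm_triangle_ineq[of "y - x" "y' - x'"]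
  by (simp add: approximates_def algebra_simps)

text \<open>Changing one factor at a time leaves the perturbed \<open>y'\<close> in one term,
  bounded by \<open>(1 + \<epsilon>) ^ m' * b'\<close>. The two error factors then telescope to
  \<open>(1 + \<epsilon>) ^ (m + m') - 1\<close>.\<close>

lemma approximates_mult:
  assumes "approximates \<epsilon> m b x y" "approximates \<epsilon> m' b' x' y'" "\<epsilon> \<ge> 0"
  shows "approximates \<epsilon> (m + m') (b * b') (x * x') (y * y')"
proof -
  have x: "norm x \<le> b" "norm (y - x) \<le> ((1 + \<epsilon>) ^ m - 1) * b"
    and x': "norm x' \<le> b'" "norm (y' - x') \<le> ((1 + \<epsilon>) ^ m' - 1) * b'"
    using assms(1,2) by (auto simp: approximates_def)
  have y': "norm y' \<le> (1 + \<epsilon>) ^ m' * b'"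
    using norm_triangle_ineq[of "y' - x'" x'] x' by (simp add: algebra_simps)
  have b: "0 \<le> b" "0 \<le> b'"
    using x(1) x'(1) norm_ge_zero order_trans by blast+
  have "y * y' - x * x' = (y - x) * y' + x * (y' - x')"
    by (simp add: algebra_simps)
  then have "norm (y * y' - x * x') \<le> norm (y - x) * norm y' + norm x * norm (y' - x')"
    by (metis norm_mult norm_triangle_ineq)
  also have "\<dots> \<le> ((1 + \<epsilon>) ^ m - 1) * b * ((1 + \<epsilon>) ^ m' * b') + b * (((1 + \<epsilon>) ^ m' - 1) * b')"
    using x x' y' b assms(3) by (intro add_mono mult_mono) auto
  also have "\<dots> = ((1 + \<epsilon>) ^ (m + m') - 1) * (b * b')"
    by (simp add: algebra_simps power_add)
  finally show ?thesis
    using x x' b by (auto simp: approximates_def norm_mult intro!: mult_mono)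
qed

text \<open>The coefficient is exact, hence of order 0; only the rounding of the product raises the
  order.\<close>

lemma approximates_scaled_rounded:
  assumes "approximates \<epsilon> m b x y" "rounded \<epsilon> (c * y) z" "\<epsilon> \<ge> 0"
  shows "approximates \<epsilon> (Suc m) (norm c * b) (c * x) z"
  using approximates_rounded[OF approximates_mult[OF approximates_refl[of \<epsilon> c] assms(1,3)] assms(2,3)]
  by simp

section \<open>Pairwise summation and linear combinations\<close>

text \<open>\<open>(n + 1) div 2\<close> is the length of the longer half in a balanced summation,
  so this is the recursion for the depth of the summation tree.\<close>

lemma ceillog2_half:
  assumes "n \<ge> 2"
  shows "ceillog2 n = Suc (ceillog2 ((n + 1) div 2))"
proof (cases "even n")
  case True
  then obtain q where "n = 2 * q" by (rule evenE)
  then show ?thesis using assms ceillog2_rec_even[of q] by simp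
next
  case False
  then obtain q where "n = 2 * q + 1" by (rule oddE)
  then show ?thesis using assms ceillog2_rec_odd[of q] by simp
qed

lemma sum_list_take_drop:
  fixes f :: "'b \<Rightarrow> 'a::monoid_add"
  shows "(\<Sum>q\<leftarrow>take n qs. f q) + (\<Sum>q\<leftarrow>drop n qs. f q) = (\<Sum>q\<leftarrow>qs. f q)"
  by (metis append_take_drop_id map_append sum_list_append)

text \<open>Each term passes through at most \<open>ceillog2 (length Ts)\<close> rounded additions.
  The index list \<open>qs\<close> lets sizes and exact values be split in step with the computed
  terms.\<close>

lemma fl_pairwise_sum_approximates:
  assumes "fl_pairwise_sum \<epsilon> d Ts Z" "\<epsilon> \<ge> 0" "i < d" "j < d"
    and "list_all2 (\<lambda>q T. approximates \<epsilon> m (b q) (x q) (T $$ (i, j))) qs Ts"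
  shows "approximates \<epsilon> (m + ceillog2 (length Ts)) (\<Sum>q\<leftarrow>qs. b q) (\<Sum>q\<leftarrow>qs. x q) (Z $$ (i, j))"
  using assms(1,5)
proof (induction arbitrary: qs)
  case empty
  then show ?case using assms(3,4) by (simp add: approximates_def)
next
  case (single X)
  then show ?case by (auto simp: list_all2_Cons2)
next
  case (split Xs S T Z)
  define h where "h = (length Xs + 1) div 2"
  have h: "h \<le> length Xs" "length Xs - h \<le> h"
    using split.hyps(1) by (auto simp: h_def)
  have log: "ceillog2 (length Xs) = Suc (ceillog2 h)"
    using ceillog2_half[OF split.hyps(1)] by (simp add: h_def)
  have "approximates \<epsilon> (m + ceillog2 h) (\<Sum>q\<leftarrow>take h qs. b q) (\<Sum>q\<leftarrow>take h qs. x q) (S $$ (i, j))"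
    using split.IH(1)[of "take h qs", folded h_def] split.prems h
    by (simp add: list_all2_takeI min_absorb2)
  \<comment> \<open>The second half is no longer than the first, so its order can be raised to that
    of the first; \<open>approximates_add\<close> requires equal orders.\<close>
  moreover have "approximates \<epsilon> (m + ceillog2 h) (\<Sum>q\<leftarrow>drop h qs. b q) (\<Sum>q\<leftarrow>drop h qs. x q) (T $$ (i, j))"
    using split.prems h assms(2)
    by (intro approximates_mono[OF split.IH(2)[folded h_def]])
      (auto simp: list_all2_dropI intro: ceillog2_mono)
  moreover have "rounded \<epsilon> (S $$ (i, j) + T $$ (i, j)) (Z $$ (i, j))"
    using split.hyps assms(3,4) by (auto simp: fl_add_mat_def)
  ultimately have "approximates \<epsilon> (Suc (m + ceillog2 h))
      ((\<Sum>q\<leftarrow>take h qs. b q) + (\<Sum>q\<leftarrow>drop h qs. b q))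
      ((\<Sum>q\<leftarrow>take h qs. x q) + (\<Sum>q\<leftarrow>drop h qs. x q)) (Z $$ (i, j))"
    using approximates_rounded approximates_add assms(2) by blast
  then show ?case by (simp add: log sum_list_take_drop)
qed

lemma sum_list_filter_upt:
  fixes f :: "nat \<Rightarrow> 'a::comm_monoid_add"
  assumes "\<And>q. \<not> P q \<Longrightarrow> f q = 0"
  shows "(\<Sum>q\<leftarrow>filter P [0..<N]. f q) = (\<Sum>q<N. f q)"
  using assms by (simp add: sum_list_distinct_conv_sum_set atLeast0LessThan)
    (intro sum.mono_neutral_left, auto)

text \<open>Scaling costs one rounding, the pairwise summation the rest. Vanishing coefficients add
  nothing, so both sums may run over all \<open>q < N\<close> although the algorithm skips those
  terms.\<close>

lemma fl_lincomb_approximates: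
  assumes "fl_lincomb \<epsilon> d N c X' Z" "\<epsilon> \<ge> 0" "i < d" "j < d"
    and "\<And>q. q < N \<Longrightarrow> approximates \<epsilon> m (b q) (x q) (X' q $$ (i, j))"
  shows "approximates \<epsilon> (m + 1 + ceillog2 (card {q. q < N \<and> c q \<noteq> 0}))
    (\<Sum>q<N. norm (c q) * b q) (\<Sum>q<N. c q * x q) (Z $$ (i, j))"
proof -
  define qs where "qs = filter (\<lambda>q. c q \<noteq> 0) [0..<N]"
  obtain Ts where Ts: "list_all2 (\<lambda>q. fl_smult_mat \<epsilon> d (c q) (X' q)) qs Ts"
    and Z: "fl_pairwise_sum \<epsilon> d Ts Z"
    using assms(1) unfolding fl_lincomb_def qs_def by blast
  have "list_all2 (\<lambda>q T. approximates \<epsilon> (m + 1) (norm (c q) * b q) (c q * x q) (T $$ (i, j))) qs Ts"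
    using Ts
  proof (rule list.rel_mono_strong)
    fix q T assume "q \<in> set qs" "fl_smult_mat \<epsilon> d (c q) (X' q) T"
    then show "approximates \<epsilon> (m + 1) (norm (c q) * b q) (c q * x q) (T $$ (i, j))"
      using assms(2-5) approximates_scaled_rounded
      by (fastforce simp: fl_smult_mat_def qs_def)
  qed
  from fl_pairwise_sum_approximates[OF Z assms(2-4) this]
  have "approximates \<epsilon> (m + 1 + ceillog2 (length Ts)) (\<Sum>q\<leftarrow>qs. norm (c q) * b q)
      (\<Sum>q\<leftarrow>qs. c q * x q) (Z $$ (i, j))" .
  moreover have "length Ts = card {q. q < N \<and> c q \<noteq> 0}"
    using list_all2_lengthD[OF Ts] distinct_card[of qs]
    by (simp add: qs_def conj_commute)
  moreover have "(\<Sum>q\<leftarrow>qs. norm (c q) * b q) = (\<Sum>q<N. norm (c q) * b q)"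
    "(\<Sum>q\<leftarrow>qs. c q * x q) = (\<Sum>q<N. c q * x q)"
    unfolding qs_def by (rule sum_list_filter_upt, simp)+
  ultimately show ?thesis by simp
qed

section \<open>The maximum-entry norm\<close>

lemma max_norm_ge:
  assumes "M \<in> carrier_mat r c" "i < r" "j < c"
  shows "norm (M $$ (i, j)) \<le> max_norm M"
proof -
  have "finite (elements_mat M)" by (simp add: elements_mat_def)
  then show ?thesis
    unfolding max_norm_def using assms by (intro Max_ge) auto
qed

lemma max_norm_le:
  assumes "M \<in> carrier_mat r c" "0 < r" "0 < c"
    and "\<And>i j. i < r \<Longrightarrow> j < c \<Longrightarrow> norm (M $$ (i, j)) \<le> b"
  shows "max_norm M \<le> b"
proof -
  have "finite (elements_mat M)" by (simp add: elements_mat_def)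
  \<comment> \<open>\<open>Max\<close> is only meaningful on a nonempty set; positive dimensions
    supply an entry.\<close>
  moreover have "M $$ (0, 0) \<in> elements_mat M" using assms by auto
  ultimately show ?thesis
    unfolding max_norm_def using assms by (subst Max_le_iff) auto
qed

lemma max_norm_nonneg:
  assumes "M \<in> carrier_mat r c" "0 < r" "0 < c"
  shows "0 \<le> max_norm M"
  using max_norm_ge[OF assms] norm_ge_zero order_trans by blast

text \<open>Only nonzero coefficients contribute. Applied to the columns of \<open>U\<close> and
  \<open>V\<close>, this brings the counts \<open>nnz_col\<close> into the bound.\<close>

lemma sum_norm_nonzero_le:
  fixes c :: "nat \<Rightarrow> 'a::real_normed_field"
  assumes "\<And>q. q < N \<Longrightarrow> norm (c q) \<le> u" "0 \<le> a"
  shows "(\<Sum>q<N. norm (c q) * a) \<le> real (card {q. q < N \<and> c q \<noteq> 0}) * u * a"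
proof -
  have "(\<Sum>q<N. norm (c q)) = (\<Sum>q\<in>{q. q < N \<and> c q \<noteq> 0}. norm (c q))"
    by (intro sum.mono_neutral_right) auto
  also have "\<dots> \<le> real (card {q. q < N \<and> c q \<noteq> 0}) * u"
    using assms(1) by (intro sum_bounded_above) auto
  finally show ?thesis
    using assms(2) by (simp add: sum_distrib_right[symmetric] mult_right_mono)
qed

section \<open>Multiplication by blocks\<close>

lemma block_mult:
  assumes "A \<in> carrier_mat (k * d) (k * d)" "B \<in> carrier_mat (k * d) (k * d)" "h < k" "l < k"
  shows "block d (A * B) h l = mat_sum d k (\<lambda>q. block d A h q * block d B q l)"
proof (rule eq_matI)
  fix i j
  assume "i < dim_row (mat_sum d k (\<lambda>q. block d A h q * block d B q l))"
    and "j < dim_col (mat_sum d k (\<lambda>q. block d A h q * block d B q l))"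
  then have ij: "i < d" "j < d" by (auto simp: mat_sum_def)
  have lt: "a * d + b < k * d" if "a < k" "b < d" for a b
  proof -
    have "a * d + b < Suc a * d" using that by simp
    also have "\<dots> \<le> k * d" using that by (intro mult_le_mono1) auto
    finally show ?thesis .
  qed
  have "block d (A * B) h l $$ (i, j) = (\<Sum>x<k * d. A $$ (h * d + i, x) * B $$ (x, l * d + j))"
    using assms ij lt by (auto simp: block_def scalar_prod_def atLeast0LessThan)
  \<comment> \<open>The inner index is cut into \<open>k\<close> intervals of length
    \<open>d\<close>, one per block.\<close>
  also have "\<dots> = (\<Sum>q<k. \<Sum>x\<in>{q * d..<q * d + d}. A $$ (h * d + i, x) * B $$ (x, l * d + j))"
    by (rule sum.nat_group[symmetric])
  also have "\<dots> = (\<Sum>q<k. \<Sum>x<d. A $$ (h * d + i, q * d + x) * B $$ (q * d + x, l * d + j))"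
  proof (rule sum.cong[OF refl])
    fix q
    show "(\<Sum>x\<in>{q * d..<q * d + d}. A $$ (h * d + i, x) * B $$ (x, l * d + j)) =
        (\<Sum>x<d. A $$ (h * d + i, q * d + x) * B $$ (q * d + x, l * d + j))"
      by (rule sum.reindex_bij_witness[of _ "\<lambda>x. q * d + x" "\<lambda>x. x - q * d"]) auto
  qed
  also have "\<dots> = mat_sum d k (\<lambda>q. block d A h q * block d B q l) $$ (i, j)"
    using ij by (auto simp: mat_sum_def block_def scalar_prod_def atLeast0LessThan)
  finally show "block d (A * B) h l $$ (i, j) = mat_sum d k (\<lambda>q. block d A h q * block d B q l) $$ (i, j)" .
qed (auto simp: block_def mat_sum_def)

section \<open>The second-order remainder\<close>

text \<open>The remainder \<open>r\<close> for \<open>N\<close> turns into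
  \<open>(1 + \<epsilon>) * r + N * \<epsilon>\<^sup>2\<close> for \<open>Suc N\<close>. As
  \<open>1 + \<epsilon> \<le> 2\<close> and \<open>N \<le> 4 ^ N\<close>, this is at most three
  times the bound for \<open>N\<close>, and four times is allowed.\<close>

lemma one_plus_power_remainder_le:
  fixes \<epsilon> :: real
  assumes "0 \<le> \<epsilon>" "\<epsilon> \<le> 1"
  shows "0 \<le> (1 + \<epsilon>) ^ N - 1 - real N * \<epsilon> \<and> (1 + \<epsilon>) ^ N - 1 - real N * \<epsilon> \<le> 4 ^ N * \<epsilon>\<^sup>2"
proof (induction N)
  case (Suc N)
  define r where "r = (1 + \<epsilon>) ^ N - 1 - real N * \<epsilon>"
  have r: "0 \<le> r" "r \<le> 4 ^ N * \<epsilon>\<^sup>2" using Suc by (auto simp: r_def)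
  have eq: "(1 + \<epsilon>) ^ Suc N - 1 - real (Suc N) * \<epsilon> = (1 + \<epsilon>) * r + real N * \<epsilon>\<^sup>2"
    by (simp add: r_def algebra_simps power2_eq_square)
  have "(1 + \<epsilon>) * r \<le> 2 * (4 ^ N * \<epsilon>\<^sup>2)"
    using assms r by (intro mult_mono) auto
  moreover have "real N \<le> 4 ^ N"
    using of_nat_less_two_power[of N, where ?'a = real] power_mono[of "2::real" 4 N] by simp
  then have "real N * \<epsilon>\<^sup>2 \<le> 4 ^ N * \<epsilon>\<^sup>2"
    by (intro mult_right_mono) auto
  ultimately show ?case
    unfolding eq using assms r by (auto intro: add_nonneg_nonneg)
qed auto

lemma one_plus_power_remainder_bigo:
  "(\<lambda>\<epsilon>::real. ((1 + \<epsilon>) ^ N - 1 - real N * \<epsilon>) * c) \<in> O[at_right 0](\<lambda>\<epsilon>. \<epsilon>\<^sup>2)"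
proof (rule bigoI)
  have "eventually (\<lambda>\<epsilon>::real. \<epsilon> \<in> {0<..<1}) (at_right 0)"
    by (rule eventually_at_right_real) simp
  then show "eventually (\<lambda>\<epsilon>::real. norm (((1 + \<epsilon>) ^ N - 1 - real N * \<epsilon>) * c) \<le> (4 ^ N * \<bar>c\<bar>) * norm (\<epsilon>\<^sup>2))
      (at_right 0)"
  proof eventually_elim
    case (elim \<epsilon>)
    then show ?case
      using one_plus_power_remainder_le[of \<epsilon> N]
        mult_right_mono[of "(1 + \<epsilon>) ^ N - 1 - real N * \<epsilon>" "4 ^ N * \<epsilon>\<^sup>2" "\<bar>c\<bar>"]
      by (simp add: abs_mult mult_ac)
  qed
qed

section \<open>Constants of a fixed bilinear algorithm\<close>

context
  fixes k t :: nat and U V W :: "'a::real_normed_field mat"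
  assumes k2: "k \<ge> 2" and t1: "t \<ge> 1" and bilinear: "bilinear_algorithm k t U V W"
begin

lemma coefficient_carriers:
  "U \<in> carrier_mat (k\<^sup>2) t" "V \<in> carrier_mat (k\<^sup>2) t" "W \<in> carrier_mat (k\<^sup>2) t"
  using bilinear by (auto simp: bilinear_algorithm_def)

text \<open>Rule form of the hypothesis, applied to 1 by 1 matrices in \<open>growth_pos\<close> and
  to blocks of size \<open>k ^ p\<close> in the recursion.\<close>

lemma bilinear_identity:
  assumes "\<And>h l. h < k \<Longrightarrow> l < k \<Longrightarrow> A h l \<in> carrier_mat d d \<and> B h l \<in> carrier_mat d d"
    and "h < k" "l < k"
  shows "mat_sum d k (\<lambda>q. A h q * B q l) =
    mat_sum d t (\<lambda>s. W $$ (k * h + l, s) \<cdot>\<^sub>m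
      (mat_sum d (k\<^sup>2) (\<lambda>i. U $$ (i, s) \<cdot>\<^sub>m colwise k A i) *
       mat_sum d (k\<^sup>2) (\<lambda>j. V $$ (j, s) \<cdot>\<^sub>m colwise k B j)))"
  using bilinear[unfolded bilinear_algorithm_def, THEN conjunct2, THEN conjunct2, THEN conjunct2,
      THEN spec, of d, THEN spec, of A, THEN spec, of B] assms
  by simp

text \<open>The constant \<open>M\<close> of the overview, written as in the definition of
  \<open>\<mu>\<close> so that it can be folded there.\<close>

definition order_step :: nat where
  "order_step = (MAX (r, s)\<in>{..<k\<^sup>2} \<times> {..<t}.
     ceillog2 (nnz_col U s) + ceillog2 (nnz_col V s) + ceillog2 (nnz_row W r) + 3)"

text \<open>The constant \<open>K\<close> of the overview: the factor gained by the size at each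
  level of recursion.\<close>

definition growth :: real where
  "growth = real (emax k t U V W) * max_norm U * max_norm V * max_norm W"

lemma order_step_ge:
  assumes "r < k\<^sup>2" "s < t"
  shows "ceillog2 (nnz_col U s) + ceillog2 (nnz_col V s) + ceillog2 (nnz_row W r) + 3 \<le> order_step"
  unfolding order_step_def
  by (rule Max_ge) (use assms in \<open>auto intro!: image_eqI[of _ _ "(r, s)"]\<close>)

lemma max_norms_nonneg: "0 \<le> max_norm U" "0 \<le> max_norm V" "0 \<le> max_norm W"
  using coefficient_carriers max_norm_nonneg[of _ "k\<^sup>2" t] k2 t1 by auto

text \<open>A zero \<open>W $$ (r, s)\<close> contributes nothing, any other at most
  \<open>max_norm W\<close>, so the products of counts add up to e_r, which is at most
  \<open>emax\<close>.\<close>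

lemma sum_norm_le_growth:
  assumes "r < k\<^sup>2" "0 \<le> c"
  shows "(\<Sum>s<t. norm (W $$ (r, s)) *
      (c * (real (nnz_col U s) * max_norm U) * (real (nnz_col V s) * max_norm V))) \<le> growth * c"
proof -
  have "(\<Sum>s<t. norm (W $$ (r, s)) *
      (c * (real (nnz_col U s) * max_norm U) * (real (nnz_col V s) * max_norm V)))
    \<le> (\<Sum>s<t. real (nnz_col U s * nnz_col V s * of_bool (W $$ (r, s) \<noteq> 0)) *
        (max_norm U * max_norm V * max_norm W * c))"
  proof (rule sum_mono)
    fix s assume "s \<in> {..<t}"
    then have "norm (W $$ (r, s)) \<le> max_norm W"
      using max_norm_ge coefficient_carriers(3) assms by blast
    then have "norm (W $$ (r, s)) * (c * (real (nnz_col U s) * max_norm U) * (real (nnz_col V s) * max_norm V))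
       \<le> max_norm W * (c * (real (nnz_col U s) * max_norm U) * (real (nnz_col V s) * max_norm V))"
      using max_norms_nonneg assms by (intro mult_right_mono) auto
    then show "norm (W $$ (r, s)) *
      (c * (real (nnz_col U s) * max_norm U) * (real (nnz_col V s) * max_norm V))
      \<le> real (nnz_col U s * nnz_col V s * of_bool (W $$ (r, s) \<noteq> 0)) *
        (max_norm U * max_norm V * max_norm W * c)"
      by (cases "W $$ (r, s) = 0") (simp_all add: mult_ac)
  qed
  also have "\<dots> = real (\<Sum>s<t. nnz_col U s * nnz_col V s * of_bool (W $$ (r, s) \<noteq> 0)) *
      (max_norm U * max_norm V * max_norm W * c)"
    by (simp only: of_nat_sum sum_distrib_right)
  also have "\<dots> \<le> real (emax k t U V W) * (max_norm U * max_norm V * max_norm W * c)"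
    unfolding emax_def using max_norms_nonneg assms
    by (intro mult_right_mono of_nat_mono Max_ge) auto
  finally show ?thesis by (simp add: growth_def mult_ac)
qed

lemma U_V_column_sum_le:
  assumes "s < t" "0 \<le> a"
  shows "(\<Sum>i<k\<^sup>2. norm (U $$ (i, s)) * a) \<le> real (nnz_col U s) * max_norm U * a"
    and "(\<Sum>i<k\<^sup>2. norm (V $$ (i, s)) * a) \<le> real (nnz_col V s) * max_norm V * a"
  using sum_norm_nonzero_le[of "k\<^sup>2" "\<lambda>i. U $$ (i, s)" "max_norm U" a]
    sum_norm_nonzero_le[of "k\<^sup>2" "\<lambda>i. V $$ (i, s)" "max_norm V" a]
    coefficient_carriers max_norm_ge[of _ "k\<^sup>2" t _ s] assms
  by (auto simp: nnz_col_def)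

text \<open>
  Positivity matters because \<open>0 powr 0 = 0\<close>, so that \<open>\<mu> k t U V W 1\<close> would vanish if \<open>growth\<close> did.
  It follows by applying the algorithm to the all-ones \<open>k \<times> k\<close> matrices.
\<close>

lemma growth_pos: "0 < growth"
proof -
  \<comment> \<open>The bilinear identity speaks of matrix entries, so the scalar 1 becomes the 1 by
    1 identity matrix.\<close>
  define J :: "nat \<Rightarrow> nat \<Rightarrow> 'a mat" where "J = (\<lambda>_ _. 1\<^sub>m 1)"
  define L where "L s = (\<Sum>i<k\<^sup>2. U $$ (i, s))" for s
  define R where "R s = (\<Sum>i<k\<^sup>2. V $$ (i, s))" for s
  have "0 < k" "0 < k\<^sup>2" using k2 by auto
  have "mat_sum 1 k (\<lambda>q. J 0 q * J q 0) = mat_sum 1 t (\<lambda>s. W $$ (k * 0 + 0, s) \<cdot>\<^sub>m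
      (mat_sum 1 (k\<^sup>2) (\<lambda>i. U $$ (i, s) \<cdot>\<^sub>m colwise k J i) *
       mat_sum 1 (k\<^sup>2) (\<lambda>j. V $$ (j, s) \<cdot>\<^sub>m colwise k J j)))"
    using \<open>0 < k\<close> by (intro bilinear_identity) (auto simp: J_def)
  then have "mat_sum 1 k (\<lambda>q. J 0 q * J q 0) $$ (0, 0) = mat_sum 1 t (\<lambda>s. W $$ (k * 0 + 0, s) \<cdot>\<^sub>m
      (mat_sum 1 (k\<^sup>2) (\<lambda>i. U $$ (i, s) \<cdot>\<^sub>m colwise k J i) *
       mat_sum 1 (k\<^sup>2) (\<lambda>j. V $$ (j, s) \<cdot>\<^sub>m colwise k J j))) $$ (0, 0)"
    by simp
  \<comment> \<open>Each entry of the product of two all-ones matrices is \<open>k\<close>, and the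
    linear forms become column sums of \<open>U\<close> and \<open>V\<close>. Bounding the
    right-hand side will give \<open>k \<le> growth\<close>.\<close>
  then have "of_nat k = (\<Sum>s<t. W $$ (0, s) * (L s * R s))"
    by (simp add: mat_sum_def J_def colwise_def scalar_prod_def L_def R_def)
  then have "real k = norm (\<Sum>s<t. W $$ (0, s) * (L s * R s))"
    by (metis norm_of_nat)
  also have "\<dots> \<le> (\<Sum>s<t. norm (W $$ (0, s)) *
      (1 * (real (nnz_col U s) * max_norm U) * (real (nnz_col V s) * max_norm V)))"
  proof (rule sum_norm_le)
    fix s assume "s \<in> {..<t}"
    then have s: "s < t" by simp
    have "norm (L s) \<le> real (nnz_col U s) * max_norm U" "norm (R s) \<le> real (nnz_col V s) * max_norm V"
      using U_V_column_sum_le[OF s, of 1] norm_sum[of "\<lambda>i. U $$ (i, s)" "{..<k\<^sup>2}"]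
        norm_sum[of "\<lambda>i. V $$ (i, s)" "{..<k\<^sup>2}"] by (auto simp: L_def R_def)
    then show "norm (W $$ (0, s) * (L s * R s)) \<le> norm (W $$ (0, s)) *
      (1 * (real (nnz_col U s) * max_norm U) * (real (nnz_col V s) * max_norm V))"
      using max_norms_nonneg by (simp add: norm_mult mult_left_mono mult_mono)
  qed
  also have "\<dots> \<le> growth * 1"
    by (rule sum_norm_le_growth[OF \<open>0 < k\<^sup>2\<close>]) simp
  finally show ?thesis using \<open>0 < k\<close> by simp
qed

section \<open>Error of the recursive algorithm\<close>

text \<open>At each level the factors gain orders 1 + \<alpha>_s and 1 + \<beta>_s, and the final
  combination gains 1 + \<gamma>_r, together at most \<open>order_step\<close>. The extra 1 is the
  scalar multiplication at the bottom.\<close>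

lemma fl_rec_mult_approximates:
  assumes "\<epsilon> \<ge> 0" "0 \<le> a" "0 \<le> b"
    and "fl_rec_mult \<epsilon> k t U V W p A' B' C'"
    and "A \<in> carrier_mat (k ^ p) (k ^ p)" "B \<in> carrier_mat (k ^ p) (k ^ p)"
    and "\<And>i j. i < k ^ p \<Longrightarrow> j < k ^ p \<Longrightarrow> approximates \<epsilon> m a (A $$ (i, j)) (A' $$ (i, j))"
    and "\<And>i j. i < k ^ p \<Longrightarrow> j < k ^ p \<Longrightarrow> approximates \<epsilon> m' b (B $$ (i, j)) (B' $$ (i, j))"
    and "i < k ^ p" "j < k ^ p"
  shows "approximates \<epsilon> (m + m' + 1 + order_step * p) (growth ^ p * a * b)
    ((A * B) $$ (i, j)) (C' $$ (i, j))"
  using assms(2-)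
proof (induction p arbitrary: a b A B A' B' C' m m' i j)
  case 0
  then have "approximates \<epsilon> (m + m') (a * b) (A $$ (0, 0) * B $$ (0, 0)) (A' $$ (0, 0) * B' $$ (0, 0))"
    using assms(1) by (intro approximates_mult) auto
  with 0 assms(1) show ?case
    using approximates_rounded by (fastforce simp: scalar_prod_def)
next
  case (Suc p)
  define d where "d = k ^ p"
  have "0 < d" using k2 by (simp add: d_def)
  obtain L R P where
    LRP: "\<forall>s<t.
      fl_lincomb \<epsilon> d (k\<^sup>2) (\<lambda>i. U $$ (i, s)) (colwise k (block d A')) (L s) \<and>
      fl_lincomb \<epsilon> d (k\<^sup>2) (\<lambda>j. V $$ (j, s)) (colwise k (block d B')) (R s) \<and>
      fl_rec_mult \<epsilon> k t U V W p (L s) (R s) (P s)" and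
    C: "\<forall>h<k. \<forall>l<k. fl_lincomb \<epsilon> d t (\<lambda>s. W $$ (k * h + l, s)) P (block d C' h l)"
    using Suc.prems(3) unfolding d_def fl_rec_mult.simps by (elim conjE exE)
  have L: "fl_lincomb \<epsilon> d (k\<^sup>2) (\<lambda>i. U $$ (i, s)) (colwise k (block d A')) (L s)"
    and R: "fl_lincomb \<epsilon> d (k\<^sup>2) (\<lambda>j. V $$ (j, s)) (colwise k (block d B')) (R s)"
    and P: "fl_rec_mult \<epsilon> k t U V W p (L s) (R s) (P s)" if "s < t" for s
    using LRP that by simp_all
  \<comment> \<open>The exact counterparts of \<open>L s\<close> and \<open>R s\<close>, formed from
    \<open>A\<close> and \<open>B\<close>.\<close>
  define LL where "LL s = mat_sum d (k\<^sup>2) (\<lambda>i. U $$ (i, s) \<cdot>\<^sub>m colwise k (block d A) i)" for s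
  define RR where "RR s = mat_sum d (k\<^sup>2) (\<lambda>i. V $$ (i, s) \<cdot>\<^sub>m colwise k (block d B) i)" for s
  have LL: "LL s \<in> carrier_mat d d" and RR: "RR s \<in> carrier_mat d d" for s
    by (auto simp: LL_def RR_def mat_sum_def)
  have lt: "x * d + y < k ^ Suc p" if "x < k" "y < d" for x y
  proof -
    have "x * d + y < Suc x * d" using that by simp
    also have "\<dots> \<le> k * d" using that by (intro mult_le_mono1) auto
    finally show ?thesis by (simp add: d_def)
  qed
  have colwise_lt: "q mod k < k" "q div k < k" if "q < k\<^sup>2" for q
    using that k2 by (auto simp: power2_eq_square less_mult_imp_div_less)
  have L_approx: "approximates \<epsilon> (m + 1 + ceillog2 (nnz_col U s)) (real (nnz_col U s) * max_norm U * a)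
      (LL s $$ (x, y)) (L s $$ (x, y))" if "s < t" "x < d" "y < d" for s x y
  proof -
    have "approximates \<epsilon> m a (colwise k (block d A) q $$ (x, y)) (colwise k (block d A') q $$ (x, y))"
      if "q < k\<^sup>2" for q
      using Suc.prems(6) lt colwise_lt[OF that] \<open>x < d\<close> \<open>y < d\<close> by (simp add: colwise_def block_def)
    from fl_lincomb_approximates[OF L[OF that(1)] assms(1) that(2,3) this]
    have "approximates \<epsilon> (m + 1 + ceillog2 (nnz_col U s)) (\<Sum>q<k\<^sup>2. norm (U $$ (q, s)) * a)
      (LL s $$ (x, y)) (L s $$ (x, y))"
      using coefficient_carriers that by (simp add: LL_def mat_sum_def nnz_col_def colwise_def block_def)
    then show ?thesis
      using approximates_mono assms(1) U_V_column_sum_le(1)[OF \<open>s < t\<close> Suc.prems(1)] by blast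
  qed
  have R_approx: "approximates \<epsilon> (m' + 1 + ceillog2 (nnz_col V s)) (real (nnz_col V s) * max_norm V * b)
      (RR s $$ (x, y)) (R s $$ (x, y))" if "s < t" "x < d" "y < d" for s x y
  proof -
    have "approximates \<epsilon> m' b (colwise k (block d B) q $$ (x, y)) (colwise k (block d B') q $$ (x, y))"
      if "q < k\<^sup>2" for q
      using Suc.prems(7) lt colwise_lt[OF that] \<open>x < d\<close> \<open>y < d\<close> by (simp add: colwise_def block_def)
    from fl_lincomb_approximates[OF R[OF that(1)] assms(1) that(2,3) this]
    have "approximates \<epsilon> (m' + 1 + ceillog2 (nnz_col V s)) (\<Sum>q<k\<^sup>2. norm (V $$ (q, s)) * b)
      (RR s $$ (x, y)) (R s $$ (x, y))"
      using coefficient_carriers that by (simp add: RR_def mat_sum_def nnz_col_def colwise_def block_def)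
    then show ?thesis
      using approximates_mono assms(1) U_V_column_sum_le(2)[OF \<open>s < t\<close> Suc.prems(2)] by blast
  qed
  \<comment> \<open>Entry \<open>(i, j)\<close> lies in block \<open>(h, l)\<close> at position
    \<open>(x, y)\<close>.\<close>
  define h where "h = i div d"
  define l where "l = j div d"
  define x where "x = i mod d"
  define y where "y = j mod d"
  have xy: "x < d" "y < d" using \<open>0 < d\<close> by (auto simp: x_def y_def)
  have hl: "h < k" "l < k"
    using Suc.prems(8,9) by (auto simp: h_def l_def d_def less_mult_imp_div_less)
  have ij: "i = h * d + x" "j = l * d + y"
    by (simp_all add: h_def l_def x_def y_def)
  have r: "k * h + l < k\<^sup>2"
  proof -
    have "k * h + l < k * Suc h" using hl by simp
    also have "\<dots> \<le> k * k" using hl by (intro mult_le_mono2) auto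
    finally show ?thesis by (simp add: power2_eq_square)
  qed
  define g where "g = ceillog2 (nnz_row W (k * h + l))"
  have g: "ceillog2 (nnz_col U s) + ceillog2 (nnz_col V s) + g + 3 \<le> order_step" if "s < t" for s
    using order_step_ge[OF r that] by (simp add: g_def)
  \<comment> \<open>This keeps the subtraction of \<open>g\<close> below from being truncated;
    \<open>t \<ge> 1\<close> provides the column 0.\<close>
  have g3: "g + 3 \<le> order_step" using g[of 0] t1 by simp
  \<comment> \<open>\<open>fl_lincomb_approximates\<close> needs one order for all terms, so
    \<alpha>_s + \<beta>_s + 3 is replaced by its bound \<open>order_step - g\<close>, leaving room
    for the final summation.\<close>
  have P_approx: "approximates \<epsilon> (m + m' + order_step * p + order_step - g)
      (growth ^ p * a * b * (real (nnz_col U s) * max_norm U) * (real (nnz_col V s) * max_norm V))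
      ((LL s * RR s) $$ (x, y)) (P s $$ (x, y))" if "s < t" for s
  proof -
    have "approximates \<epsilon> ((m + 1 + ceillog2 (nnz_col U s)) + (m' + 1 + ceillog2 (nnz_col V s)) + 1 + order_step * p)
       (growth ^ p * (real (nnz_col U s) * max_norm U * a) * (real (nnz_col V s) * max_norm V * b))
       ((LL s * RR s) $$ (x, y)) (P s $$ (x, y))"
      using Suc.prems(1,2) max_norms_nonneg P[OF that] L_approx[OF that] R_approx[OF that] LL RR xy
      unfolding d_def by (intro Suc.IH) auto
    then show ?thesis
      by (rule approximates_mono) (use assms(1) g[OF that] in \<open>auto simp: mult_ac\<close>)
  qed
  from fl_lincomb_approximates[OF C[rule_format, OF hl] assms(1) xy P_approx]
  have "approximates \<epsilon> (m + m' + order_step * p + order_step - g + 1 + g)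
      (\<Sum>s<t. norm (W $$ (k * h + l, s)) * (growth ^ p * a * b *
         (real (nnz_col U s) * max_norm U) * (real (nnz_col V s) * max_norm V)))
      (\<Sum>s<t. W $$ (k * h + l, s) * (LL s * RR s) $$ (x, y)) (block d C' h l $$ (x, y))"
    using coefficient_carriers by (simp add: g_def nnz_row_def)
  moreover have "block d C' h l $$ (x, y) = C' $$ (i, j)"
    using xy ij by (simp add: block_def)
  \<comment> \<open>The bilinear identity is used here with the blocks as non-commuting
    entries.\<close>
  moreover have "(\<Sum>s<t. W $$ (k * h + l, s) * (LL s * RR s) $$ (x, y)) = (A * B) $$ (i, j)"
  proof -
    have "(A * B) $$ (i, j) = block d (A * B) h l $$ (x, y)"
      using xy ij by (simp add: block_def)
    also have "block d (A * B) h l = mat_sum d k (\<lambda>q. block d A h q * block d B q l)"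
      using Suc.prems(4,5) hl by (intro block_mult) (auto simp: d_def)
    also have "\<dots> = mat_sum d t (\<lambda>s. W $$ (k * h + l, s) \<cdot>\<^sub>m (LL s * RR s))"
      unfolding LL_def RR_def using hl by (intro bilinear_identity) (auto simp: block_def)
    also have "\<dots> $$ (x, y) = (\<Sum>s<t. W $$ (k * h + l, s) * (LL s * RR s) $$ (x, y))"
      using xy carrier_matD[OF LL] carrier_matD[OF RR] by (simp add: mat_sum_def)
    finally show ?thesis by simp
  qed
  \<comment> \<open>The outer combination supplies the next factor \<open>growth\<close>.\<close>
  moreover have "(\<Sum>s<t. norm (W $$ (k * h + l, s)) * (growth ^ p * a * b *
         (real (nnz_col U s) * max_norm U) * (real (nnz_col V s) * max_norm V)))
      \<le> growth * (growth ^ p * a * b)"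
    using growth_pos Suc.prems(1,2) by (intro sum_norm_le_growth[OF r]) auto
  ultimately have "approximates \<epsilon> (m + m' + order_step * p + order_step - g + 1 + g)
      (growth * (growth ^ p * a * b)) ((A * B) $$ (i, j)) (C' $$ (i, j))"
    using approximates_mono[OF _ assms(1) order_refl] by simp
  then show ?case
    using g3 by (simp add: mult.assoc add_ac)
qed

section \<open>Closed form of the bound and stability\<close>

text \<open>The logarithm is exactly \<open>p\<close>, and by \<open>growth_pos\<close> the
  \<open>powr\<close> is an ordinary power, also for \<open>p = 0\<close>.\<close>

lemma \<mu>_power: "\<mu> k t U V W (k ^ p) = real (1 + order_step * p) * growth ^ p"
proof -
  have "log (real k) (real (k ^ p)) = real p"
    using k2 by (simp add: log_nat_power)
  then show ?thesis
    using growth_pos unfolding \<mu>_def order_step_def[symmetric] growth_def[symmetric]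
    by (simp add: powr_realpow)
qed

end

theorem theorem3p1:
  fixes U V W A B :: "'a::real_normed_field mat" and k t n p :: nat
  assumes "k \<ge> 2" and "t \<ge> 1"
    and "bilinear_algorithm k t U V W"
    and "n = k ^ p"
    and "A \<in> carrier_mat n n" and "B \<in> carrier_mat n n"
  shows "\<exists>R \<in> O[at_right 0](\<lambda>\<epsilon>. \<epsilon>\<^sup>2). \<forall>\<epsilon>>0. \<forall>C\<^sub>c\<^sub>o\<^sub>m\<^sub>p.
           fl_rec_mult \<epsilon> k t U V W p A B C\<^sub>c\<^sub>o\<^sub>m\<^sub>p \<longrightarrow>
           max_norm (C\<^sub>c\<^sub>o\<^sub>m\<^sub>p - A * B) \<le> \<mu> k t U V W n * \<epsilon> * max_norm A * max_norm B + R \<epsilon>"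
proof (intro bexI allI impI)
  \<comment> \<open>Exact inputs have order 0 and their norms as sizes; \<open>N\<close> and
    \<open>c\<close> are the resulting order and size of the output.\<close>
  define N where "N = 1 + order_step k t U V W * p"
  define c where "c = growth k t U V W ^ p * max_norm A * max_norm B"
  \<comment> \<open>What remains of \<open>((1 + \<epsilon>) ^ N - 1) * c\<close> after its linear
    part. It does not depend on the individual rounding errors, which gives the uniformity.\<close>
  let ?R = "\<lambda>\<epsilon>. ((1 + \<epsilon>) ^ N - 1 - real N * \<epsilon>) * c"
  show "?R \<in> O[at_right 0](\<lambda>\<epsilon>. \<epsilon>\<^sup>2)"
    by (rule one_plus_power_remainder_bigo)
  fix \<epsilon> :: real and C assume "\<epsilon> > 0" and C: "fl_rec_mult \<epsilon> k t U V W p A B C"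
  have "0 < n" using assms(1,4) by simp
  have C_carrier: "C \<in> carrier_mat n n"
    using C assms(4) by (cases p) auto
  have nonneg: "0 \<le> max_norm A" "0 \<le> max_norm B"
    using max_norm_nonneg assms(5,6) \<open>0 < n\<close> by blast+
  have "max_norm (C - A * B) \<le> ((1 + \<epsilon>) ^ N - 1) * c"
  proof (rule max_norm_le[OF _ \<open>0 < n\<close> \<open>0 < n\<close>])
    fix i j assume ij: "i < n" "j < n"
    have approx: "approximates \<epsilon> 0 (max_norm M) (M $$ (i, j)) (M $$ (i, j))"
      if "M \<in> carrier_mat n n" "i < n" "j < n" for M :: "'a mat" and i j
      using max_norm_ge[OF that] by (simp add: approximates_def)
    have "approximates \<epsilon> (0 + 0 + 1 + order_step k t U V W * p)
        (growth k t U V W ^ p * max_norm A * max_norm B) ((A * B) $$ (i, j)) (C $$ (i, j))"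
      using assms \<open>\<epsilon> > 0\<close> C nonneg approx ij
      by (intro fl_rec_mult_approximates[where A' = A and B' = B]) auto
    then show "norm ((C - A * B) $$ (i, j)) \<le> ((1 + \<epsilon>) ^ N - 1) * c"
      using assms(5,6) C_carrier ij by (simp add: approximates_def N_def c_def)
  qed (use assms C_carrier in auto)
  \<comment> \<open>The linear coefficient \<open>N * c\<close> is precisely \<open>\<mu>\<close>
    times the norms of \<open>A\<close> and \<open>B\<close>.\<close>
  also have "\<dots> = \<mu> k t U V W n * \<epsilon> * max_norm A * max_norm B + ?R \<epsilon>"
    unfolding assms(4) \<mu>_power[OF assms(1-3)] N_def c_def by (simp add: algebra_simps)
  finally show "max_norm (C - A * B) \<le> \<mu> k t U V W n * \<epsilon> * max_norm A * max_norm B + ?R \<epsilon>" .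
qed

end
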